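(* The family $$\{\mathsf{F}_\lambda A_C(X)\mid C\in\Bbbk,\ \lambda\in\Bbbk^\times,\ X\subseteq R_{u+C}\text{ a submultiset}\}$$ is a skeleton of the category $\mathfrak{U}_1$; that is, every $\mathcal{S}_u$-module in $\mathfrak{U}_1$ is isomorphic to $\mathsf{F}_\lambda A_C(X)$ for exactly one triple $(C,\lambda,X)$ with $C\in\Bbbk$, $\lambda\in\Bbbk^\times$ and $X$ a submultiset of $R_{u+C}$ (and all these modules lie in $\mathfrak{U}_1$).
   Context: $\Bbbk$ is an algebraically closed field of characteristic zero. Fix a nonzero polynomial $g(h)\in\Bbbk[h]$ and a polynomial $u(h)\in\Bbbk[h]$ with $g(h)=u(h-1)-u(h)$ (such $u$ exists, is unique up to its constant term, and $\deg u=\deg g+1\geq 1$). The Smith algebra $\mathcal{S}_u$ is the unital associative $\Bbbk$-algebra generated by $x,y,h$ with defining relations $[h,y]=y$, $[h,x]=-x$, $[y,x]=g(h)$. $\mathfrak{U}_1$ is the full subcategory of (left) $\mathcal{S}_u$-modules that are free of rank one over the subalgebra $\Bbbk[h]$. $R_f$ denotes the multiset of roots of a nonzero polynomial $f$ (with multiplicity). For $C\in\Bbbk$ and a submultiset $X\subseteq R_{u+C}$, put $q(h)=\prod_{\alpha\in X}(h-\alpha)$ (with multiplicity; empty product $=1$) and $p(h)=\frac{u(h-1)+C}{q(h-1)}\in\Bbbk[h]$. The module $A_C(X)$ is $\Bbbk[h]$ with $h$ acting by multiplication and $x\cdot f(h)=f(h+1)q(h)$, $y\cdot f(h)=f(h-1)p(h)$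 for all $f\in\Bbbk[h]$. For $\lambda\in\Bbbk^\times$, let $\varphi_\lambda$ be the algebra automorphism of $\mathcal{S}_u$ with $x\mapsto\lambda x$, $y\mapsto\lambda^{-1}y$, $h\mapsto h$; for an $\mathcal{S}_u$-module $M$, $\mathsf{F}_\lambda M$ is $M$ with the twisted action $s\cdot m=\varphi_\lambda(s)m$. *)

theory Defs
  imports
    "HOL-Library.Poly_Mapping"
    "HOL-Computational_Algebra.Polynomial"
    "HOL-Algebra.Module"
    "HOL-Algebra.QuotRing"
    "HOL-Algebra.Generated_Rings"
begin

section \<open>The free algebra on three generators\<close>

datatype gen = GX | GY | GH

text \<open>A separate type for words, so that addition of words is concatenation and the
  convolution product of \<open>word \<Rightarrow>\<^sub>0 'k\<close> is the product of noncommutative polynomials.\<close>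

datatype word = Word (letters: "gen list")

instantiation word :: monoid_add
begin

definition zero_word :: word where "0 = Word []"

definition plus_word :: "word \<Rightarrow> word \<Rightarrow> word" where
  "v + w = Word (letters v @ letters w)"

instance
  by standard (simp_all add: zero_word_def plus_word_def)

end

type_synonym 'k free_alg = "word \<Rightarrow>\<^sub>0 'k"

definition fconst :: "'k::field \<Rightarrow> 'k free_alg" where
  "fconst c = Poly_Mapping.single 0 c"

definition fgen :: "gen \<Rightarrow> 'k::field free_alg" where
  "fgen t = Poly_Mapping.single (Word [t]) 1"

definition free_ring :: "'k::field free_alg ring" where
  "free_ring = \<lparr>carrier = UNIV, monoid.mult = (*), one = 1, zero = 0, add = (+)\<rparr>"

definition fpoly_h :: "'k::field poly \<Rightarrow> 'k free_alg" where
  "fpoly_h p = (\<Sum>i\<le>degree p. fconst (poly.coeff p i) * fgen GH ^ i)"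

text \<open>The algebra endomorphism of the free algebra that sends each generator \<open>t\<close> to \<open>\<sigma> t\<close>.\<close>

definition free_endo :: "(gen \<Rightarrow> 'k free_alg) \<Rightarrow> 'k::field free_alg \<Rightarrow> 'k free_alg" where
  "free_endo \<sigma> a =
     (\<Sum>w\<in>Poly_Mapping.keys a. fconst (Poly_Mapping.lookup a w) * prod_list (map \<sigma> (letters w)))"

text \<open>The representation of the free algebra on \<open>k[h]\<close> in which each generator \<open>t\<close> acts as
  the linear operator \<open>T t\<close>; a word acts as the composite of its letters, the last letter first.\<close>

definition free_act ::
    "(gen \<Rightarrow> 'k poly \<Rightarrow> 'k poly) \<Rightarrow> 'k::field free_alg \<Rightarrow> 'k poly \<Rightarrow> 'k poly" where
  "free_act T a f =
     (\<Sum>w\<in>Poly_Mapping.keys a. Polynomial.smult (Poly_Mapping.lookup a w) (foldr T (letters w) f))"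


section \<open>The Smith algebra\<close>

definition smith_relations :: "'k::field poly \<Rightarrow> 'k free_alg set" where
  "smith_relations g =
    {fgen GH * fgen GY - fgen GY * fgen GH - fgen GY,
     fgen GH * fgen GX - fgen GX * fgen GH + fgen GX,
     fgen GY * fgen GX - fgen GX * fgen GY - fpoly_h g}"

definition smith_ideal :: "'k::field poly \<Rightarrow> 'k free_alg set" where
  "smith_ideal g = Idl\<^bsub>free_ring\<^esub> (smith_relations g)"

text \<open>The algebra \<open>S\<^sub>u\<close> depends on \<open>u\<close> only through \<open>g\<close>. Its elements are cosets.\<close>

definition smith_algebra :: "'k::field poly \<Rightarrow> 'k free_alg set ring" where
  "smith_algebra g = free_ring Quot smith_ideal g"

definition smith_class :: "'k::field poly \<Rightarrow> 'k free_alg \<Rightarrow> 'k free_alg set" where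
  "smith_class g a = smith_ideal g +>\<^bsub>free_ring\<^esub> a"

definition smith_h_subalgebra :: "'k::field poly \<Rightarrow> 'k free_alg set set" where
  "smith_h_subalgebra g =
     generate_ring (smith_algebra g) (insert (smith_class g (fgen GH)) (range (smith_class g \<circ> fconst)))"


section \<open>Left modules\<close>

text \<open>The library's \<^locale>\<open>module\<close> requires a commutative ring of scalars. As there, the
  multiplication and unit fields of the record \<open>M\<close> play no role.\<close>

locale left_module = R?: ring R + M?: abelian_group M
  for R :: "('s, 'r) ring_scheme" (structure) and M :: "('s, 'm, 'z) module_scheme" (structure) +
  assumes smult_closed:
      "\<lbrakk>a \<in> carrier R; m \<in> carrier M\<rbrakk> \<Longrightarrow> a \<odot>\<^bsub>M\<^esub> m \<in> carrier M"
    and smult_l_distr: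
      "\<lbrakk>a \<in> carrier R; b \<in> carrier R; m \<in> carrier M\<rbrakk> \<Longrightarrow>
        (a \<oplus>\<^bsub>R\<^esub> b) \<odot>\<^bsub>M\<^esub> m = a \<odot>\<^bsub>M\<^esub> m \<oplus>\<^bsub>M\<^esub> b \<odot>\<^bsub>M\<^esub> m"
    and smult_r_distr:
      "\<lbrakk>a \<in> carrier R; m \<in> carrier M; n \<in> carrier M\<rbrakk> \<Longrightarrow>
        a \<odot>\<^bsub>M\<^esub> (m \<oplus>\<^bsub>M\<^esub> n) = a \<odot>\<^bsub>M\<^esub> m \<oplus>\<^bsub>M\<^esub> a \<odot>\<^bsub>M\<^esub> n"
    and smult_assoc:
      "\<lbrakk>a \<in> carrier R; b \<in> carrier R; m \<in> carrier M\<rbrakk> \<Longrightarrow>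
        (a \<otimes>\<^bsub>R\<^esub> b) \<odot>\<^bsub>M\<^esub> m = a \<odot>\<^bsub>M\<^esub> (b \<odot>\<^bsub>M\<^esub> m)"
    and smult_one:
      "m \<in> carrier M \<Longrightarrow> \<one>\<^bsub>R\<^esub> \<odot>\<^bsub>M\<^esub> m = m"

definition module_iso ::
    "('s, 'r) ring_scheme \<Rightarrow> ('s, 'm, 'a) module_scheme \<Rightarrow> ('s, 'n, 'b) module_scheme \<Rightarrow>
      ('m \<Rightarrow> 'n) \<Rightarrow> bool" where
  "module_iso R M N \<phi> \<longleftrightarrow>
     bij_betw \<phi> (carrier M) (carrier N) \<and>
     (\<forall>m\<in>carrier M. \<forall>n\<in>carrier M. \<phi> (m \<oplus>\<^bsub>M\<^esub> n) = \<phi> m \<oplus>\<^bsub>N\<^esub> \<phi> n) \<and>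
     (\<forall>a\<in>carrier R. \<forall>m\<in>carrier M. \<phi> (a \<odot>\<^bsub>M\<^esub> m) = a \<odot>\<^bsub>N\<^esub> \<phi> m)"

definition modules_isomorphic ::
    "('s, 'r) ring_scheme \<Rightarrow> ('s, 'm, 'a) module_scheme \<Rightarrow> ('s, 'n, 'b) module_scheme \<Rightarrow> bool" where
  "modules_isomorphic R M N \<longleftrightarrow> (\<exists>\<phi>. module_iso R M N \<phi>)"

text \<open>\<open>B\<close> is a subring of the scalars; the condition says that \<open>{v}\<close> is a \<open>B\<close>-basis.\<close>

definition free_of_rank_one_over :: "'s set \<Rightarrow> ('s, 'm, 'a) module_scheme \<Rightarrow> bool" where
  "free_of_rank_one_over B M \<longleftrightarrow>
     (\<exists>v\<in>carrier M. bij_betw (\<lambda>b. b \<odot>\<^bsub>M\<^esub> v) B (carrier M))"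

definition in_U1 :: "'k::field poly \<Rightarrow> ('k free_alg set, 'm, 'a) module_scheme \<Rightarrow> bool" where
  "in_U1 g M \<longleftrightarrow>
     left_module (smith_algebra g) M \<and> free_of_rank_one_over (smith_h_subalgebra g) M"


section \<open>The modules \<open>A\<^sub>C(X)\<close> and the twists \<open>F\<^sub>\<lambda>\<close>\<close>

definition q_poly :: "'k::field multiset \<Rightarrow> 'k poly" where
  "q_poly X = (\<Prod>\<alpha>\<in>#X. [:-\<alpha>, 1:])"

text \<open>\<^term>\<open>pcompose f [:c, 1:]\<close> is \<open>f(h + c)\<close>; the division is exact when \<open>X \<subseteq># proots (u + [:C:])\<close>.\<close>

definition p_poly :: "'k::field poly \<Rightarrow> 'k \<Rightarrow> 'k multiset \<Rightarrow> 'k poly" where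
  "p_poly u C X = (pcompose u [:-1, 1:] + [:C:]) div pcompose (q_poly X) [:-1, 1:]"

fun A_gen_act :: "'k::field poly \<Rightarrow> 'k \<Rightarrow> 'k multiset \<Rightarrow> gen \<Rightarrow> 'k poly \<Rightarrow> 'k poly" where
  "A_gen_act u C X GH f = [:0, 1:] * f"
| "A_gen_act u C X GX f = pcompose f [:1, 1:] * q_poly X"
| "A_gen_act u C X GY f = pcompose f [:-1, 1:] * p_poly u C X"

text \<open>An element \<open>s\<close> of the Smith algebra is a coset and acts through any of its representatives.\<close>

definition A_module :: "'k::field poly \<Rightarrow> 'k \<Rightarrow> 'k multiset \<Rightarrow> ('k free_alg set, 'k poly) module" where
  "A_module u C X =
    \<lparr>carrier = UNIV, monoid.mult = (*), one = 1, zero = 0, add = (+),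
     smult = (\<lambda>s. free_act (A_gen_act u C X) (SOME a. a \<in> s))\<rparr>"

fun twist_gen :: "'k::field \<Rightarrow> gen \<Rightarrow> 'k free_alg" where
  "twist_gen l GX = fconst l * fgen GX"
| "twist_gen l GY = fconst (inverse l) * fgen GY"
| "twist_gen l GH = fgen GH"

text \<open>The automorphism \<open>\<phi>\<^sub>\<lambda>\<close> (for \<open>\<lambda> \<noteq> 0\<close>): the endomorphism of the free algebra given by
  \<^const>\<open>twist_gen\<close>, applied to a representative of the coset.\<close>

definition smith_twist :: "'k::field poly \<Rightarrow> 'k \<Rightarrow> 'k free_alg set \<Rightarrow> 'k free_alg set" where
  "smith_twist g l s = smith_class g (free_endo (twist_gen l) (SOME a. a \<in> s))"

definition twist_module ::
    "'k::field poly \<Rightarrow> 'k \<Rightarrow> ('k free_alg set, 'm) module \<Rightarrow> ('k free_alg set, 'm) module" where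
  "twist_module g l M = M\<lparr>smult := (\<lambda>s m. smith_twist g l s \<odot>\<^bsub>M\<^esub> m)\<rparr>"

end

theory Submission
  imports Defs
begin

text \<open>
  Let \<open>M\<close> be free of rank one over \<open>k[h]\<close> with basis element \<open>v\<close>, and put \<open>x v = q(h) v\<close> and
  \<open>y v = p(h) v\<close>. Since \<open>x h = (h + 1) x\<close> and \<open>y h = (h - 1) y\<close>, these two polynomials determine \<open>M\<close>:
  \<open>x\<close> acts on \<open>k[h] v\<close> by \<open>f(h) \<mapsto> f(h + 1) q(h)\<close> and \<open>y\<close> by \<open>f(h) \<mapsto> f(h - 1) p(h)\<close>. Conversely,
  such shift operators satisfy the relations of the Smith algebra if and only if
  \<open>q(h - 1) p(h) - p(h + 1) q(h) = g(h)\<close> (\<open>shift_relation\<close>). The pair \<open>(q, p)\<close> does not depend on \<open>v\<close>,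
  because another basis element is a nonzero constant multiple of \<open>v\<close>. So isomorphism classes of
  modules of rank one are the same as pairs \<open>(q, p)\<close> that satisfy this relation
  (\<open>in_U1_shift_module\<close>, \<open>in_U1_imp_shift_module\<close>, \<open>shift_module_iso_imp_eq\<close>).

  As \<open>g(h) = u(h - 1) - u(h)\<close>, the relation says that \<open>p(h + 1) q(h) - u(h)\<close> is invariant under the
  shift, hence a constant \<open>C\<close> in characteristic zero. The pairs are therefore the factorizations
  \<open>p(h + 1) q(h) = u(h) + C\<close>. Over an algebraically closed field \<open>q\<close> is given by its leading
  coefficient \<open>\<lambda>\<close> and its multiset of roots \<open>X \<subseteq> R\<^bsub>u+C\<^esub>\<close>, and \<open>p\<close> is the complementary factor
  (\<open>bij_betw_operator_pair\<close>). The pair of \<open>(C, \<lambda>, X)\<close> is that of \<open>F\<^sub>\<lambda> A\<^sub>C(X)\<close>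
  (\<open>twist_A_module_eq\<close>).
\<close>

section \<open>The Smith algebra as a quotient\<close>

lemma ring_free_ring: "ring (free_ring :: 'k::field free_alg ring)"
proof (rule ringI)
  show "abelian_group (free_ring :: 'k free_alg ring)"
  proof (rule abelian_groupI)
    fix a :: "'k free_alg"
    show "\<exists>b\<in>carrier free_ring. b \<oplus>\<^bsub>free_ring\<^esub> a = \<zero>\<^bsub>free_ring\<^esub>"
      by (intro bexI[of _ "- a"]) (simp_all add: free_ring_def)
  qed (simp_all add: free_ring_def algebra_simps)
  show "Group.monoid (free_ring :: 'k free_alg ring)"
    by (rule monoidI) (simp_all add: free_ring_def algebra_simps)
qed (simp_all add: free_ring_def algebra_simps)

lemma free_ring_uminus: "\<ominus>\<^bsub>free_ring\<^esub> b = - (b :: 'k::field free_alg)"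
proof -
  interpret ring "free_ring :: 'k free_alg ring" by (rule ring_free_ring)
  show ?thesis
    by (rule minus_equality) (simp_all add: free_ring_def)
qed

lemma free_ring_minus: "a \<ominus>\<^bsub>free_ring\<^esub> b = a - (b :: 'k::field free_alg)"
  by (simp add: a_minus_def free_ring_uminus) (simp add: free_ring_def)

lemma ideal_smith_ideal: "ideal (smith_ideal g) (free_ring :: 'k::field free_alg ring)"
  unfolding smith_ideal_def
  by (rule ring.genideal_ideal[OF ring_free_ring]) (simp add: free_ring_def)

lemma ring_smith_algebra: "ring (smith_algebra g)"
  unfolding smith_algebra_def by (rule ideal.quotient_is_ring[OF ideal_smith_ideal])

lemma smith_class_eq_iff: "smith_class g a = smith_class g b \<longleftrightarrow> a - b \<in> smith_ideal g"
  unfolding smith_class_def free_ring_minus[symmetric]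
  by (rule ring.quotient_eq_iff_same_a_r_cos[OF ring_free_ring ideal_smith_ideal, symmetric])
     (simp_all add: free_ring_def)

lemma carrier_smith_algebra: "carrier (smith_algebra g) = range (smith_class g)"
  by (auto simp: smith_algebra_def smith_class_def[abs_def] FactRing_def A_RCOSETS_def'
      free_ring_def)

lemma smith_class_closed: "smith_class g a \<in> carrier (smith_algebra g)"
  by (simp add: carrier_smith_algebra)

lemma smith_class_add:
  "smith_class g a \<oplus>\<^bsub>smith_algebra g\<^esub> smith_class g b = smith_class g (a + b)"
  using ideal.a_rcos_sum[OF ideal_smith_ideal, of a b g]
  by (simp add: smith_algebra_def smith_class_def FactRing_def)
     (simp add: free_ring_def)

lemma smith_class_mult:
  "smith_class g a \<otimes>\<^bsub>smith_algebra g\<^esub> smith_class g b = smith_class g (a * b)"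
  using ideal.rcoset_mult_add[OF ideal_smith_ideal, of a b g]
  by (simp add: smith_algebra_def smith_class_def FactRing_def)
     (simp add: free_ring_def)

lemma smith_class_one: "\<one>\<^bsub>smith_algebra g\<^esub> = smith_class g 1"
  by (simp add: smith_algebra_def smith_class_def FactRing_def) (simp add: free_ring_def)

lemma smith_class_uminus:
  "\<ominus>\<^bsub>smith_algebra g\<^esub> smith_class g a = smith_class g (- a)"
proof -
  interpret ring "smith_algebra g" by (rule ring_smith_algebra)
  have "smith_class g 0 = \<zero>\<^bsub>smith_algebra g\<^esub>"
    using smith_class_add[of g 0 0] add.l_cancel_one'[OF smith_class_closed smith_class_closed, of 0 0]
    by simp
  then show ?thesis
    by (intro minus_equality) (simp_all add: smith_class_closed smith_class_add)
qed

lemma smith_class_self: "a \<in> smith_class g a"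
proof -
  have "additive_subgroup (smith_ideal g) free_ring"
    using ideal_smith_ideal by (rule ideal.axioms)
  then have "0 \<in> smith_ideal g"
    using additive_subgroup.zero_closed by (fastforce simp: free_ring_def)
  then show ?thesis
    by (auto simp: smith_class_def a_r_coset_def' free_ring_def)
qed

text \<open>Modules and twists apply to a coset by choosing a representative; the choice does not leave
  the coset.\<close>

lemma smith_class_some: "smith_class g (SOME b. b \<in> smith_class g a) = smith_class g a"
proof -
  have "b - a \<in> smith_ideal g" if "b \<in> smith_class g a" for b
    using that by (auto simp: smith_class_def a_r_coset_def' free_ring_def)
  then show ?thesis
    unfolding smith_class_eq_iff by (metis smith_class_self someI)
qed

lemma smith_class_eqI:
  assumes "a - b \<in> smith_relations g"
  shows "smith_class g a = smith_class g b"
  using assms ring.genideal_self[OF ring_free_ring, of "smith_relations g"]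
  by (auto simp: smith_class_eq_iff smith_ideal_def free_ring_def)

section \<open>Induction over the free algebra\<close>

lemma fconst_simps:
  "fconst 0 = 0" "fconst 1 = 1" "fconst (c + d) = fconst c + fconst d"
  "fconst (c * d) = fconst c * fconst d" "fconst (- c) = - fconst c"
  by (simp_all add: fconst_def single_add mult_single single_uminus)

lemma single_eq_fconst_mult:
  "(Poly_Mapping.single w c :: 'k::field free_alg) = fconst c * prod_list (map fgen (letters w))"
proof -
  have "prod_list (map fgen ws) = Poly_Mapping.single (Word ws) (1 :: 'k)" for ws
    by (induction ws)
      (simp_all add: fgen_def mult_single plus_word_def flip: zero_word_def)
  then show ?thesis
    by (simp add: fconst_def mult_single del: single_one)
qed

lemma free_alg_decompose:
  "(a :: 'k::field free_alg) =
    (\<Sum>w\<in>Poly_Mapping.keys a. Poly_Mapping.single w (Poly_Mapping.lookup a w))"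
  by (rule poly_mapping_eqI) (simp add: lookup_sum lookup_single when_def in_keys_iff)

lemma free_alg_additive_induct [case_names single add]:
  assumes single: "\<And>w c. P (Poly_Mapping.single w c)"
    and add: "\<And>a b. P a \<Longrightarrow> P b \<Longrightarrow> P (a + b)"
  shows "P (a :: 'k::field free_alg)"
proof -
  have "P 0" using single[of 0 0] by simp
  then have "P (\<Sum>w\<in>A. Poly_Mapping.single w (Poly_Mapping.lookup a w))" for A
    by (induction A rule: infinite_finite_induct) (simp_all add: single add)
  then show ?thesis
    by (subst free_alg_decompose)
qed

lemma free_alg_induct [case_names const gen add mult]:
  assumes const: "\<And>c. P (fconst c)"
    and gen: "\<And>t. P (fgen t)"
    and add: "\<And>a b. P a \<Longrightarrow> P b \<Longrightarrow> P (a + b)"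
    and mult: "\<And>a b. P a \<Longrightarrow> P b \<Longrightarrow> P (a * b)"
  shows "P (a :: 'k::field free_alg)"
proof -
  have 1: "P 1" using const[of 1] by (simp add: fconst_simps)
  have "P (prod_list (map fgen ws))" for ws
    by (induction ws) (simp_all add: 1 gen mult)
  then have "P (Poly_Mapping.single w c)" for w c
    by (simp add: single_eq_fconst_mult const mult)
  then show ?thesis
    by (induction a rule: free_alg_additive_induct) (simp_all add: add)
qed

section \<open>Polynomials in \<open>h\<close>\<close>

lemma fconst_commute: "fconst c * a = a * (fconst c :: 'k::field free_alg)"
proof (induction a rule: free_alg_induct)
  case (mult a b)
  then show ?case by (metis mult.assoc)
qed (simp_all add: fconst_def fgen_def mult_single algebra_simps)

lemma fpoly_h_0: "fpoly_h 0 = 0"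
  by (simp add: fpoly_h_def fconst_simps)

lemma fpoly_h_pCons: "fpoly_h (pCons c f) = fconst c + fgen GH * fpoly_h f"
proof (cases "f = 0")
  case True
  then show ?thesis by (simp add: fpoly_h_def fconst_simps)
next
  case False
  then show ?thesis
    by (simp add: fpoly_h_def sum.atMost_Suc_shift sum_distrib_left power_Suc del: sum.atMost_Suc)
       (simp add: mult.assoc[symmetric] fconst_commute[of _ "fgen GH"])
qed

lemma fpoly_h_const: "fpoly_h [:c:] = fconst c"
  by (simp add: fpoly_h_pCons fpoly_h_0)

lemma fpoly_h_add: "fpoly_h (f + g) = fpoly_h f + fpoly_h g"
proof (induction f g rule: poly_induct2)
qed (simp_all add: fpoly_h_0 fpoly_h_pCons fconst_simps algebra_simps)

lemma fpoly_h_smult: "fpoly_h (Polynomial.smult c f) = fconst c * fpoly_h f"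
  by (induction f)
     (simp_all add: fpoly_h_0 fpoly_h_pCons fconst_simps distrib_left mult.assoc[symmetric],
      simp add: fconst_commute[of c "fgen GH"])

lemma fpoly_h_mult: "fpoly_h (f * g) = fpoly_h f * fpoly_h g"
  by (induction f)
     (simp_all add: fpoly_h_0 fpoly_h_pCons fpoly_h_add fpoly_h_smult fconst_simps distrib_right mult.assoc)

lemma fpoly_h_uminus: "fpoly_h (- f) = - fpoly_h f"
  using fpoly_h_add[of f "- f"] by (simp add: fpoly_h_0 eq_neg_iff_add_eq_0 add.commute)

section \<open>Representations of the free algebra on polynomials\<close>

lemma free_act_superset:
  assumes "finite A" "Poly_Mapping.keys a \<subseteq> A"
  shows "free_act T a f = (\<Sum>w\<in>A. Polynomial.smult (Poly_Mapping.lookup a w) (foldr T (letters w) f))"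
  unfolding free_act_def using assms
  by (intro sum.mono_neutral_left) (auto simp: in_keys_iff)

lemma free_act_add: "free_act T (a + b) f = free_act T a f + free_act T b f"
proof -
  let ?A = "Poly_Mapping.keys a \<union> Poly_Mapping.keys b"
  have "Poly_Mapping.keys (a + b) \<subseteq> ?A" by (rule keys_add)
  then show ?thesis
    by (simp add: free_act_superset[of ?A] lookup_add smult_add_left sum.distrib)
qed

lemma free_act_0: "free_act T 0 f = 0"
  by (simp add: free_act_def)

lemma free_act_uminus: "free_act T (- a) f = - free_act T a f"
  using free_act_add[of T a "- a" f] by (simp add: free_act_0 eq_neg_iff_add_eq_0 add.commute)

lemma free_act_diff: "free_act T (a - b) f = free_act T a f - free_act T b f"
  using free_act_add[of T a "- b" f] by (simp add: free_act_uminus)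

lemma free_act_sum: "free_act T (sum a A) f = (\<Sum>i\<in>A. free_act T (a i) f)"
  by (induction A rule: infinite_finite_induct) (simp_all add: free_act_0 free_act_add)

lemma free_act_single:
  "free_act T (Poly_Mapping.single w c) f = Polynomial.smult c (foldr T (letters w) f)"
  by (simp add: free_act_superset[of "{w}"])

lemma free_act_fconst: "free_act T (fconst c) f = Polynomial.smult c f"
  by (simp add: fconst_def free_act_single zero_word_def)

lemma free_act_fgen: "free_act T (fgen t) f = T t f"
  by (simp add: fgen_def free_act_single)

lemma free_act_1: "free_act T 1 f = f"
  using free_act_fconst[of T 1 f] by (simp add: fconst_simps)

locale linear_operators =
  fixes T :: "gen \<Rightarrow> 'k::field poly \<Rightarrow> 'k poly"
  assumes operator_add: "T t (f + f') = T t f + T t f'"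
    and operator_smult: "T t (Polynomial.smult c f) = Polynomial.smult c (T t f)"
begin

lemma word_add: "foldr T ws (f + f') = foldr T ws f + foldr T ws f'"
  by (induction ws) (simp_all add: operator_add)

lemma word_smult: "foldr T ws (Polynomial.smult c f) = Polynomial.smult c (foldr T ws f)"
  by (induction ws) (simp_all add: operator_smult)

lemma act_add_right: "free_act T a (f + f') = free_act T a f + free_act T a f'"
  by (simp add: free_act_def word_add smult_add_right sum.distrib)

lemma act_mult: "free_act T (a * b) f = free_act T a (free_act T b f)"
proof (induction a rule: free_alg_additive_induct)
  case (single w c)
  show ?case
  proof (induction b rule: free_alg_additive_induct)
    case (single v d)
    show ?case
      by (simp add: mult_single free_act_single plus_word_def word_smult)
  next
    case (add b b')
    then show ?case
      by (simp add: distrib_left free_act_add act_add_right)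
  qed
qed (simp add: distrib_right free_act_add)

text \<open>Because \<open>\<sigma>\<close> is extended multiplicatively, it suffices to compare words. The consequence that
  matters is that a twisted module is again given by three operators, so that twisted and
  untwisted modules can be treated alike.\<close>

lemma act_free_endo: "free_act T (free_endo \<sigma> a) f = free_act (\<lambda>t. free_act T (\<sigma> t)) a f"
proof -
  have "free_act T (prod_list (map \<sigma> ws)) f = foldr (\<lambda>t. free_act T (\<sigma> t)) ws f" for ws
    by (induction ws) (simp_all add: free_act_1 act_mult)
  then show ?thesis
    by (simp add: free_endo_def free_act_sum act_mult free_act_fconst
        free_act_def[of "\<lambda>t. free_act T (\<sigma> t)"])
qed

end

section \<open>Modules over the Smith algebra given by operators\<close>

text \<open>A coset acts through a chosen representative, as in \<^const>\<open>A_module\<close>, so that the modules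
  \<open>A\<^sub>C(X)\<close> and their twists are of this form up to equality and not only up to isomorphism.\<close>

definition operator_module ::
    "(gen \<Rightarrow> 'k poly \<Rightarrow> 'k poly) \<Rightarrow> ('k::field free_alg set, 'k poly) module" where
  "operator_module T =
    \<lparr>carrier = UNIV, monoid.mult = (*), one = 1, zero = 0, add = (+),
     smult = (\<lambda>s. free_act T (SOME a. a \<in> s))\<rparr>"

text \<open>These are exactly the data that make \<open>k[h]\<close> a module over the Smith algebra on which the
  scalars act as usual.\<close>

locale smith_operators = linear_operators T for T :: "gen \<Rightarrow> 'k::field poly \<Rightarrow> 'k poly" +
  fixes g :: "'k poly"
  assumes relations_act: "r \<in> smith_relations g \<Longrightarrow> free_act T r f = 0"
begin

text \<open>The elements of the free algebra that act as zero form a two-sided ideal.\<close>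

lemma ideal_act:
  assumes "r \<in> smith_ideal g"
  shows "free_act T r f = 0"
proof -
  let ?K = "{r. \<forall>f. free_act T r f = 0}"
  have zero: "free_act T a 0 = 0" for a
    using act_add_right[of a 0 0] by (metis add_cancel_left_left add_0)
  have "ideal ?K free_ring"
  proof (rule idealI[OF ring_free_ring])
    show "subgroup ?K (add_monoid free_ring)"
    proof (rule group.subgroupI)
      show "Group.group (add_monoid (free_ring :: 'k free_alg ring))"
        using ring_free_ring by (intro abelian_group.a_group ring.is_abelian_group)
      show "inv\<^bsub>add_monoid free_ring\<^esub> b \<in> ?K" if "b \<in> ?K" for b
        unfolding a_inv_def[symmetric] using that by (simp add: free_ring_uminus free_act_uminus)
    qed (auto simp: free_ring_def free_act_add intro: exI[of _ 0] free_act_0)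
  qed (simp_all add: free_ring_def act_mult zero)
  then have "smith_ideal g \<subseteq> ?K"
    unfolding smith_ideal_def
    by (intro ring.genideal_minimal[OF ring_free_ring]) (auto simp: relations_act)
  then show ?thesis using assms by blast
qed

lemma act_cong:
  assumes "smith_class g a = smith_class g b"
  shows "free_act T a f = free_act T b f"
  using assms ideal_act[of "a - b" f] by (simp add: smith_class_eq_iff free_act_diff)

lemma operator_module_smult: "smith_class g a \<odot>\<^bsub>operator_module T\<^esub> f = free_act T a f"
  by (simp add: operator_module_def) (rule act_cong, rule smith_class_some)

lemma left_module_operator_module: "left_module (smith_algebra g) (operator_module T)"
proof -
  interpret R: ring "smith_algebra g" by (rule ring_smith_algebra)
  interpret M: abelian_group "operator_module T"
  proof (rule abelian_groupI)
    fix f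
    show "\<exists>f'\<in>carrier (operator_module T). f' \<oplus>\<^bsub>operator_module T\<^esub> f = \<zero>\<^bsub>operator_module T\<^esub>"
      by (intro bexI[of _ "- f"]) (simp_all add: operator_module_def)
  qed (simp_all add: operator_module_def algebra_simps)
  have add: "f \<oplus>\<^bsub>operator_module T\<^esub> f' = f + f'" for f f'
    by (simp add: operator_module_def)
  have carr: "f \<in> carrier (operator_module T)" for f
    by (simp add: operator_module_def)
  show ?thesis
    by unfold_locales
      (auto simp: carrier_smith_algebra carr add smith_class_add smith_class_mult
        smith_class_one operator_module_smult free_act_add act_add_right act_mult free_act_1)
qed

end

section \<open>Shift operators\<close>

fun shift_act :: "'k poly \<Rightarrow> 'k poly \<Rightarrow> gen \<Rightarrow> 'k::field poly \<Rightarrow> 'k poly" where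
  "shift_act q p GH f = [:0, 1:] * f"
| "shift_act q p GX f = pcompose f [:1, 1:] * q"
| "shift_act q p GY f = pcompose f [:-1, 1:] * p"

text \<open>If \<open>x 1 = q\<close> and \<open>y 1 = p\<close>, then \<open>y x 1 = q(h - 1) p(h)\<close> and \<open>x y 1 = p(h + 1) q(h)\<close>; so this
  is the relation \<open>[y, x] = g\<close> applied to \<open>1\<close>.\<close>

definition shift_relation :: "'k::field poly \<Rightarrow> 'k poly \<Rightarrow> 'k poly \<Rightarrow> bool" where
  "shift_relation g q p \<longleftrightarrow> pcompose q [:-1, 1:] * p - pcompose p [:1, 1:] * q = g"

lemma shift_cancel:
  "pcompose (pcompose f [:1, 1:]) [:-1, 1:] = (f :: 'k::field poly)"
  "pcompose (pcompose f [:-1, 1:]) [:1, 1:] = f"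
  by (simp_all add: pcompose_pCons flip: pcompose_assoc)

lemma linear_operators_shift_act: "linear_operators (shift_act q p)"
proof
  fix t f f' c
  show "shift_act q p t (f + f') = shift_act q p t f + shift_act q p t f'"
    by (cases t) (simp_all add: pcompose_add algebra_simps)
  show "shift_act q p t (Polynomial.smult c f) = Polynomial.smult c (shift_act q p t f)"
    by (cases t) (simp_all add: pcompose_smult)
qed

lemma shift_act_fpoly_h: "free_act (shift_act q p) (fpoly_h f) f' = f * f'"
proof -
  interpret linear_operators "shift_act q p" by (rule linear_operators_shift_act)
  show ?thesis
    by (induction f) (simp_all add: fpoly_h_0 fpoly_h_pCons free_act_0 free_act_add act_mult
        free_act_fgen free_act_fconst)
qed

text \<open>The relations of \<open>h\<close> with \<open>x\<close> and \<open>y\<close> hold for shifts with any \<open>q\<close> and \<open>p\<close>; the commutator of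
  \<open>y\<close> and \<open>x\<close> is multiplication by a polynomial, which the assumption identifies as \<open>g\<close>.\<close>

lemma smith_operators_shift_act:
  assumes "shift_relation g q p"
  shows "smith_operators (shift_act q p) g"
proof -
  interpret linear_operators "shift_act q p" by (rule linear_operators_shift_act)
  show ?thesis
  proof
    fix r f
    note eval = free_act_add free_act_diff act_mult free_act_fgen shift_act_fpoly_h
      pcompose_mult pcompose_pCons shift_cancel
    have "free_act (shift_act q p) (fgen GH * fgen GY - fgen GY * fgen GH - fgen GY) f = 0"
      by (simp add: eval algebra_simps)
    moreover have "free_act (shift_act q p) (fgen GH * fgen GX - fgen GX * fgen GH + fgen GX) f = 0"
      by (simp add: eval algebra_simps)
    moreover have "free_act (shift_act q p) (fgen GY * fgen GX - fgen GX * fgen GY - fpoly_h g) f = 0"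
      using assms by (simp add: eval shift_relation_def algebra_simps)
    moreover assume "r \<in> smith_relations g"
    ultimately show "free_act (shift_act q p) r f = 0"
      by (auto simp: smith_relations_def)
  qed
qed

section \<open>The polynomial subalgebra\<close>

lemma smith_class_mult_cong:
  "smith_class g a = smith_class g a' \<Longrightarrow> smith_class g b = smith_class g b' \<Longrightarrow>
    smith_class g (a * b) = smith_class g (a' * b')"
  by (metis smith_class_mult)

lemma smith_class_add_cong:
  "smith_class g a = smith_class g a' \<Longrightarrow> smith_class g b = smith_class g b' \<Longrightarrow>
    smith_class g (a + b) = smith_class g (a' + b')"
  by (metis smith_class_add)

text \<open>Both defining relations that involve \<open>h\<close> have the form \<open>z h = (h + e) z\<close>, with \<open>e = 1\<close> for
  \<open>z = x\<close> and \<open>e = - 1\<close> for \<open>z = y\<close>. Moving \<open>z\<close> past one factor \<open>h\<close> at a time moves it past a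
  polynomial; this is why \<open>x\<close> and \<open>y\<close> act by shifts on every module of rank one.\<close>

lemma move_past_fpoly_h:
  assumes "smith_class g (z * fgen GH) = smith_class g ((fgen GH + fconst e) * z)"
  shows "smith_class g (z * fpoly_h f) = smith_class g (fpoly_h (pcompose f [:e, 1:]) * z)"
proof (induction f)
  case 0
  show ?case by (simp add: fpoly_h_0)
next
  case (pCons c f)
  have "smith_class g (z * fgen GH * fpoly_h f) = smith_class g ((fgen GH + fconst e) * z * fpoly_h f)"
    using assms by (rule smith_class_mult_cong) simp
  also have "\<dots> = smith_class g ((fgen GH + fconst e) * (fpoly_h (pcompose f [:e, 1:]) * z))"
    unfolding mult.assoc[of _ z] using refl pCons.IH by (rule smith_class_mult_cong)
  finally have "smith_class g (fconst c * z + z * fgen GH * fpoly_h f) =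
      smith_class g (fconst c * z + (fgen GH + fconst e) * (fpoly_h (pcompose f [:e, 1:]) * z))"
    by (intro smith_class_add_cong refl)
  moreover have "z * fpoly_h (pCons c f) = fconst c * z + z * fgen GH * fpoly_h f"
    by (simp add: fpoly_h_pCons distrib_left mult.assoc fconst_commute[of c z])
  moreover have "fpoly_h (pcompose (pCons c f) [:e, 1:]) * z =
      fconst c * z + (fgen GH + fconst e) * (fpoly_h (pcompose f [:e, 1:]) * z)"
    by (simp add: pcompose_pCons fpoly_h_add fpoly_h_mult fpoly_h_pCons fpoly_h_0 fpoly_h_smult fconst_simps
        distrib_right mult.assoc add.commute add.left_commute)
  ultimately show ?case by simp
qed

lemma smith_class_X_fpoly_h:
  "smith_class g (fgen GX * fpoly_h f) = smith_class g (fpoly_h (pcompose f [:1, 1:]) * fgen GX)"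
proof (rule move_past_fpoly_h, rule sym, rule smith_class_eqI)
  have "(fgen GH + fconst 1) * fgen GX - fgen GX * fgen GH =
      fgen GH * fgen GX - fgen GX * fgen GH + (fgen GX :: 'a free_alg)"
    by (simp add: fconst_simps algebra_simps)
  then show "(fgen GH + fconst 1) * fgen GX - fgen GX * fgen GH \<in> smith_relations g"
    by (simp add: smith_relations_def)
qed

lemma smith_class_Y_fpoly_h:
  "smith_class g (fgen GY * fpoly_h f) = smith_class g (fpoly_h (pcompose f [:-1, 1:]) * fgen GY)"
proof (rule move_past_fpoly_h, rule sym, rule smith_class_eqI)
  have "(fgen GH + fconst (- 1)) * fgen GY - fgen GY * fgen GH =
      fgen GH * fgen GY - fgen GY * fgen GH - (fgen GY :: 'a free_alg)"
    by (simp add: fconst_simps algebra_simps)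
  then show "(fgen GH + fconst (- 1)) * fgen GY - fgen GY * fgen GH \<in> smith_relations g"
    by (simp add: smith_relations_def)
qed

lemma smith_class_Y_X:
  "smith_class g (fgen GY * fgen GX) = smith_class g (fgen GX * fgen GY + fpoly_h g)"
  by (rule smith_class_eqI) (simp add: smith_relations_def diff_diff_eq[symmetric])

lemma smith_h_subalgebra_eq: "smith_h_subalgebra g = range (smith_class g \<circ> fpoly_h)"
proof
  show "smith_h_subalgebra g \<subseteq> range (smith_class g \<circ> fpoly_h)"
  proof
    fix s assume "s \<in> smith_h_subalgebra g"
    then show "s \<in> range (smith_class g \<circ> fpoly_h)"
      unfolding smith_h_subalgebra_def
    proof induction
      case one
      have "\<one>\<^bsub>smith_algebra g\<^esub> = (smith_class g \<circ> fpoly_h) [:1:]"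
        by (simp add: smith_class_one fpoly_h_const fconst_simps)
      then show ?case by (rule range_eqI)
    next
      case (incl s)
      then have "s = smith_class g (fgen GH) \<or> (\<exists>c. s = smith_class g (fconst c))"
        by (simp add: image_iff)
      then show ?case
      proof (elim disjE exE)
        assume "s = smith_class g (fgen GH)"
        then have "s = (smith_class g \<circ> fpoly_h) [:0, 1:]"
          by (simp add: fpoly_h_pCons fpoly_h_0 fconst_simps)
        then show ?thesis by (rule range_eqI)
      next
        fix c assume "s = smith_class g (fconst c)"
        then have "s = (smith_class g \<circ> fpoly_h) [:c:]"
          by (simp add: fpoly_h_const)
        then show ?thesis by (rule range_eqI)
      qed
    next
      case (a_inv s)
      then obtain f where "s = smith_class g (fpoly_h f)" by auto
      then have "\<ominus>\<^bsub>smith_algebra g\<^esub> s = (smith_class g \<circ> fpoly_h) (- f)"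
        by (simp add: smith_class_uminus fpoly_h_uminus)
      then show ?case by (rule range_eqI)
    next
      case (eng_add s s')
      then obtain f f' where "s = smith_class g (fpoly_h f)" "s' = smith_class g (fpoly_h f')" by auto
      then have "s \<oplus>\<^bsub>smith_algebra g\<^esub> s' = (smith_class g \<circ> fpoly_h) (f + f')"
        by (simp add: smith_class_add fpoly_h_add)
      then show ?case by (rule range_eqI)
    next
      case (eng_mult s s')
      then obtain f f' where "s = smith_class g (fpoly_h f)" "s' = smith_class g (fpoly_h f')" by auto
      then have "s \<otimes>\<^bsub>smith_algebra g\<^esub> s' = (smith_class g \<circ> fpoly_h) (f * f')"
        by (simp add: smith_class_mult fpoly_h_mult)
      then show ?case by (rule range_eqI)
    qed
  qed
next
  have "smith_class g (fpoly_h f) \<in> smith_h_subalgebra g" for f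
  proof (induction f)
    case 0
    have "smith_class g (fconst 0) \<in> smith_h_subalgebra g"
      unfolding smith_h_subalgebra_def by (rule generate_ring.incl) auto
    then show ?case by (simp add: fpoly_h_0 fconst_simps)
  next
    case (pCons c f)
    have "smith_class g (fconst c) \<in> smith_h_subalgebra g" "smith_class g (fgen GH) \<in> smith_h_subalgebra g"
      unfolding smith_h_subalgebra_def by (auto intro: generate_ring.incl)
    then show ?case
      using pCons.IH unfolding smith_h_subalgebra_def fpoly_h_pCons
      by (metis generate_ring.eng_add generate_ring.eng_mult smith_class_add smith_class_mult)
  qed
  then show "range (smith_class g \<circ> fpoly_h) \<subseteq> smith_h_subalgebra g" by auto
qed

text \<open>On a shift module \<open>f(h)\<close> sends \<open>1\<close> to \<open>f\<close>, so the existence of one such module shows that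
  \<open>k[h]\<close> embeds into the Smith algebra.\<close>

lemma smith_class_fpoly_h_inj:
  assumes "shift_relation g q p"
  shows "smith_class g (fpoly_h f) = smith_class g (fpoly_h f') \<longleftrightarrow> f = f'"
proof -
  interpret smith_operators "shift_act q p" g
    using assms by (rule smith_operators_shift_act)
  show ?thesis
    using act_cong[of "fpoly_h f" "fpoly_h f'" 1] by (auto simp: shift_act_fpoly_h)
qed

section \<open>Modules free of rank one\<close>

lemma in_U1_shift_module:
  assumes "shift_relation g q p"
  shows "in_U1 g (operator_module (shift_act q p))"
proof -
  interpret smith_operators "shift_act q p" g
    using assms by (rule smith_operators_shift_act)
  have "bij_betw (\<lambda>b. b \<odot>\<^bsub>operator_module (shift_act q p)\<^esub> 1) (smith_h_subalgebra g) UNIV"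
    by (rule bij_betw_byWitness[where f' = "smith_class g \<circ> fpoly_h"])
      (auto simp: smith_h_subalgebra_eq operator_module_smult shift_act_fpoly_h)
  then have "free_of_rank_one_over (smith_h_subalgebra g) (operator_module (shift_act q p))"
    by (auto simp: free_of_rank_one_over_def operator_module_def)
  then show ?thesis
    using left_module_operator_module by (simp add: in_U1_def)
qed

text \<open>A basis element \<open>v\<close> identifies \<open>M\<close> with \<open>k[h]\<close>. The commutation rules determine the action
  of \<open>x\<close> and \<open>y\<close> on \<open>f(h) v\<close> from \<open>x v\<close> and \<open>y v\<close>, whose coordinates are \<open>q\<close> and \<open>p\<close>; evaluating
  \<open>[y, x] = g\<close> at \<open>v\<close> gives the condition on \<open>(q, p)\<close>. The pair \<open>(q\<^sub>0, p\<^sub>0)\<close> is any solution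
  of that condition; it provides the embedding of \<open>k[h]\<close>, by which coordinates are unique.\<close>

lemma in_U1_imp_shift_module:
  fixes M :: "('k::field free_alg set, 'm) module"
  assumes "in_U1 g M" "shift_relation g q\<^sub>0 p\<^sub>0"
  obtains q p where "shift_relation g q p"
    "modules_isomorphic (smith_algebra g) M (operator_module (shift_act q p))"
proof -
  interpret left_module "smith_algebra g" M
    using assms(1) by (simp add: in_U1_def)
  obtain v where v: "v \<in> carrier M"
    and basis: "bij_betw (\<lambda>b. b \<odot>\<^bsub>M\<^esub> v) (smith_h_subalgebra g) (carrier M)"
    using assms(1) by (auto simp: in_U1_def free_of_rank_one_over_def)
  define act where "act a m = smith_class g a \<odot>\<^bsub>M\<^esub> m" for a m
  have act_closed: "act a m \<in> carrier M" if "m \<in> carrier M" for a m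
    using that by (simp add: act_def smult_closed smith_class_closed)
  have act_add: "act (a + b) m = act a m \<oplus>\<^bsub>M\<^esub> act b m" if "m \<in> carrier M" for a b m
    using that by (simp add: act_def smult_l_distr smith_class_closed flip: smith_class_add)
  have act_mult: "act (a * b) m = act a (act b m)" if "m \<in> carrier M" for a b m
    using that by (simp add: act_def smult_assoc smith_class_closed flip: smith_class_mult)
  have act_cong: "act a m = act b m" if "smith_class g a = smith_class g b" for a b m
    using that by (simp add: act_def)
  define coord where "coord f = act (fpoly_h f) v" for f
  have bij: "bij_betw coord UNIV (carrier M)"
  proof -
    have "bij_betw (smith_class g \<circ> fpoly_h) UNIV (smith_h_subalgebra g)"
      using smith_class_fpoly_h_inj[OF assms(2)]
      by (auto simp: bij_betw_def smith_h_subalgebra_eq inj_on_def)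
    then show ?thesis
      using bij_betw_trans[OF _ basis] by (simp add: coord_def[abs_def] act_def comp_def)
  qed
  have inj: "coord f = coord f' \<longleftrightarrow> f = f'" for f f'
    using bij by (auto simp: bij_betw_def inj_on_def)
  have coord_closed: "coord f \<in> carrier M" for f
    by (simp add: coord_def act_closed v)
  have coord_add: "coord (f + f') = coord f \<oplus>\<^bsub>M\<^esub> coord f'" for f f'
    by (simp add: coord_def fpoly_h_add act_add v)
  have coord_mult: "act (fpoly_h f) (coord f') = coord (f * f')" for f f'
    by (simp add: coord_def fpoly_h_mult act_mult v)
  obtain q where q: "act (fgen GX) v = coord q"
    using bij act_closed[OF v] by (metis bij_betw_imp_surj_on imageE)
  obtain p where p: "act (fgen GY) v = coord p"
    using bij act_closed[OF v] by (metis bij_betw_imp_surj_on imageE)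
  have X: "act (fgen GX) (coord f) = coord (pcompose f [:1, 1:] * q)" for f
    using act_cong[OF smith_class_X_fpoly_h, of f v]
    by (simp add: act_mult v q coord_mult flip: coord_def)
  have Y: "act (fgen GY) (coord f) = coord (pcompose f [:-1, 1:] * p)" for f
    using act_cong[OF smith_class_Y_fpoly_h, of f v]
    by (simp add: act_mult v p coord_mult flip: coord_def)
  have "coord (pcompose q [:-1, 1:] * p) = coord (pcompose p [:1, 1:] * q + g)"
    using act_cong[OF smith_class_Y_X, of v]
    by (simp add: act_mult act_add v p q X Y coord_add flip: coord_def)
  then have rel: "shift_relation g q p"
    by (simp add: inj shift_relation_def)
  interpret T: smith_operators "shift_act q p" g
    using rel by (rule smith_operators_shift_act)
  have equivariant: "coord (free_act (shift_act q p) a f) = act a (coord f)" for a f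
  proof (induction a arbitrary: f rule: free_alg_induct)
    case (const c)
    show ?case
      using coord_mult[of "[:c:]" f] by (simp add: free_act_fconst fpoly_h_const)
  next
    case (gen t)
    show ?case
    proof (cases t)
      case GH
      then show ?thesis
        using coord_mult[of "[:0, 1:]" f]
        by (simp add: free_act_fgen fpoly_h_pCons fpoly_h_0 fconst_simps)
    qed (simp_all add: free_act_fgen X Y)
  next
    case (add a b)
    then show ?case by (simp add: free_act_add coord_add act_add coord_closed)
  next
    case (mult a b)
    then show ?case by (simp add: T.act_mult act_mult coord_closed)
  qed
  define \<phi> where "\<phi> = inv_into UNIV coord"
  have coord_phi: "coord (\<phi> m) = m" if "m \<in> carrier M" for m
    using bij that by (simp add: \<phi>_def f_inv_into_f bij_betw_imp_surj_on)
  have phi_eqI: "\<phi> m = f" if "m \<in> carrier M" "m = coord f" for m f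
    using that coord_phi inj by metis
  have "module_iso (smith_algebra g) M (operator_module (shift_act q p)) \<phi>"
    unfolding module_iso_def
  proof (intro conjI ballI)
    show "bij_betw \<phi> (carrier M) (carrier (operator_module (shift_act q p)))"
      using bij_betw_inv_into[OF bij] by (simp add: \<phi>_def operator_module_def)
  next
    fix m n assume "m \<in> carrier M" "n \<in> carrier M"
    then show "\<phi> (m \<oplus>\<^bsub>M\<^esub> n) = \<phi> m \<oplus>\<^bsub>operator_module (shift_act q p)\<^esub> \<phi> n"
      by (intro phi_eqI) (simp_all add: operator_module_def coord_add coord_phi)
  next
    fix s m assume s: "s \<in> carrier (smith_algebra g)" and m: "m \<in> carrier M"
    from s obtain a where "s = smith_class g a" by (auto simp: carrier_smith_algebra)
    then show "\<phi> (s \<odot>\<^bsub>M\<^esub> m) = s \<odot>\<^bsub>operator_module (shift_act q p)\<^esub> \<phi> m"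
      using m act_closed[OF m]
      by (intro phi_eqI) (simp_all add: T.operator_module_smult equivariant coord_phi act_def)
  qed
  then show thesis
    using rel that by (auto simp: modules_isomorphic_def)
qed

text \<open>Two members of the family to which one module is isomorphic are compared with each other,
  without reference to that module.\<close>

lemma isomorphic_to_common_module:
  assumes "left_module R M" "modules_isomorphic R M N" "modules_isomorphic R M N'"
  shows "modules_isomorphic R N N'"
proof -
  interpret left_module R M by (rule assms(1))
  obtain \<phi> \<phi>' where iso: "module_iso R M N \<phi>" "module_iso R M N' \<phi>'"
    using assms(2,3) by (auto simp: modules_isomorphic_def)
  let ?\<psi> = "inv_into (carrier M) \<phi>"
  have bij: "bij_betw \<phi> (carrier M) (carrier N)" "bij_betw \<phi>' (carrier M) (carrier N')"
    using iso by (simp_all add: module_iso_def)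
  have inv: "?\<psi> (\<phi> m) = m" if "m \<in> carrier M" for m
    using bij(1) that by (simp add: bij_betw_inv_into_left)
  have "module_iso R N N' (\<phi>' \<circ> ?\<psi>)"
    unfolding module_iso_def
  proof (intro conjI ballI)
    show "bij_betw (\<phi>' \<circ> ?\<psi>) (carrier N) (carrier N')"
      using bij by (blast intro: bij_betw_trans bij_betw_inv_into)
  next
    fix n n' assume "n \<in> carrier N" "n' \<in> carrier N"
    then obtain m m' where m: "m \<in> carrier M" "n = \<phi> m" "m' \<in> carrier M" "n' = \<phi> m'"
      unfolding bij_betw_imp_surj_on[OF bij(1), symmetric] by blast
    then have "\<phi> m \<oplus>\<^bsub>N\<^esub> \<phi> m' = \<phi> (m \<oplus>\<^bsub>M\<^esub> m')"
        "\<phi>' (m \<oplus>\<^bsub>M\<^esub> m') = \<phi>' m \<oplus>\<^bsub>N'\<^esub> \<phi>' m'"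
      using iso by (simp_all add: module_iso_def)
    then show "(\<phi>' \<circ> ?\<psi>) (n \<oplus>\<^bsub>N\<^esub> n') = (\<phi>' \<circ> ?\<psi>) n \<oplus>\<^bsub>N'\<^esub> (\<phi>' \<circ> ?\<psi>) n'"
      using m by (simp add: inv)
  next
    fix a n assume a: "a \<in> carrier R" and "n \<in> carrier N"
    then obtain m where m: "m \<in> carrier M" "n = \<phi> m"
      unfolding bij_betw_imp_surj_on[OF bij(1), symmetric] by blast
    with a have "a \<odot>\<^bsub>N\<^esub> \<phi> m = \<phi> (a \<odot>\<^bsub>M\<^esub> m)" "\<phi>' (a \<odot>\<^bsub>M\<^esub> m) = a \<odot>\<^bsub>N'\<^esub> \<phi>' m"
      using iso by (simp_all add: module_iso_def)
    then show "(\<phi>' \<circ> ?\<psi>) (a \<odot>\<^bsub>N\<^esub> n) = a \<odot>\<^bsub>N'\<^esub> (\<phi>' \<circ> ?\<psi>) n"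
      using a m by (simp add: inv smult_closed)
  qed
  then show ?thesis by (auto simp: modules_isomorphic_def)
qed

text \<open>An isomorphism is \<open>k[h]\<close>-linear, hence multiplication by the unit \<open>\<phi> 1\<close> of \<open>k[h]\<close>. A unit
  is a constant, which shifts do not change; so \<open>\<phi>\<close> preserves \<open>x 1\<close> and \<open>y 1\<close> up to the same
  factor.\<close>

lemma shift_module_iso_imp_eq:
  assumes "shift_relation g q p" "shift_relation g q' p'"
    and "modules_isomorphic (smith_algebra g) (operator_module (shift_act q p))
      (operator_module (shift_act q' p'))"
  shows "q = q' \<and> p = p'"
proof -
  interpret T: smith_operators "shift_act q p" g
    using assms(1) by (rule smith_operators_shift_act)
  interpret T': smith_operators "shift_act q' p'" g
    using assms(2) by (rule smith_operators_shift_act)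
  obtain \<phi> where bij: "bij \<phi>"
    and "\<And>a f. \<phi> (smith_class g a \<odot>\<^bsub>operator_module (shift_act q p)\<^esub> f) =
      smith_class g a \<odot>\<^bsub>operator_module (shift_act q' p')\<^esub> \<phi> f"
    using assms(3) smith_class_closed
    by (fastforce simp: modules_isomorphic_def module_iso_def operator_module_def)
  then have equivariant: "\<phi> (free_act (shift_act q p) a f) = free_act (shift_act q' p') a (\<phi> f)" for a f
    by (simp add: T.operator_module_smult T'.operator_module_smult)
  have phi: "\<phi> f = f * \<phi> 1" for f
    using equivariant[of "fpoly_h f" 1] by (simp add: shift_act_fpoly_h)
  obtain f where "1 = f * \<phi> 1"
    using bij phi by (metis bij_pointE)
  then have "\<phi> 1 dvd 1" by (metis dvd_triv_right)
  then obtain c where c: "\<phi> 1 = [:c:]" "c \<noteq> 0"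
    unfolding is_unit_poly_iff by fastforce
  have "Polynomial.smult c q = Polynomial.smult c q'" "Polynomial.smult c p = Polynomial.smult c p'"
    using equivariant[of "fgen GX" 1] equivariant[of "fgen GY" 1] phi[of q] phi[of p] c
    by (simp_all add: free_act_fgen pcompose_1)
  then show ?thesis
    using c(2) by (simp add: poly_eq_iff)
qed

section \<open>Factorizations of \<open>u + C\<close>\<close>

lemma pcompose_shift_inj:
  "pcompose f [:1, 1:] = pcompose f' [:1, 1:] \<longleftrightarrow> f = (f' :: 'k::field poly)"
  by (metis shift_cancel(1))

text \<open>In characteristic zero, \<open>w - w(0)\<close> vanishes at the infinitely many natural numbers.\<close>

lemma shift_invariant_imp_const:
  assumes "pcompose w [:-1, 1:] = (w :: 'k::field_char_0 poly)"
  shows "\<exists>c. w = [:c:]"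
proof -
  have step: "poly w (x - 1) = poly w x" for x
    using arg_cong[OF assms, of "\<lambda>w. poly w x"] by (simp add: poly_pcompose)
  have "poly w (of_nat n) = poly w 0" for n
    by (induction n) (use step[of "of_nat (Suc _)"] in simp_all)
  then have "range of_nat \<subseteq> {x. poly (w - [:poly w 0:]) x = 0}" by auto
  then have "infinite {x. poly (w - [:poly w 0:]) x = 0}"
    using infinite_UNIV_char_0 finite_subset range_inj_infinite[OF inj_of_nat] by blast
  then have "w - [:poly w 0:] = 0"
    using poly_roots_finite by blast
  then show ?thesis by auto
qed

text \<open>With \<open>w = p(h + 1) q(h) - u(h)\<close> the relation reads \<open>w(h - 1) = w(h)\<close>, so \<open>w\<close> is a constant:
  this is where the parameter \<open>C\<close> comes from. The polynomial \<open>u + C\<close> is the action of \<open>x y\<close>.\<close>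

lemma shift_relation_iff:
  fixes u q p :: "'k::field_char_0 poly"
  shows "shift_relation (pcompose u [:-1, 1:] - u) q p \<longleftrightarrow> (\<exists>C. pcompose p [:1, 1:] * q = u + [:C:])"
proof
  let ?w = "pcompose p [:1, 1:] * q - u"
  assume "shift_relation (pcompose u [:-1, 1:] - u) q p"
  then have "pcompose ?w [:-1, 1:] = ?w"
    by (simp add: shift_relation_def pcompose_diff pcompose_mult shift_cancel algebra_simps)
  then obtain C where "?w = [:C:]" using shift_invariant_imp_const by blast
  then show "\<exists>C. pcompose p [:1, 1:] * q = u + [:C:]" by (auto simp: algebra_simps)
next
  assume "\<exists>C. pcompose p [:1, 1:] * q = u + [:C:]"
  then obtain C where C: "pcompose p [:1, 1:] * q = u + [:C:]" ..
  from arg_cong[OF this, of "\<lambda>f. pcompose f [:-1, 1:]"]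
  have "p * pcompose q [:-1, 1:] = pcompose u [:-1, 1:] + [:C:]"
    by (simp add: pcompose_mult shift_cancel pcompose_add)
  with C show "shift_relation (pcompose u [:-1, 1:] - u) q p"
    by (simp add: shift_relation_def mult.commute)
qed

lemma q_poly_add: "q_poly (X + Y) = q_poly X * q_poly Y"
  by (simp add: q_poly_def)

lemma monic_q_poly: "lead_coeff (q_poly X) = 1"
  by (induction X) (simp_all add: q_poly_def lead_coeff_mult del: mult_pCons_left)

lemma q_poly_nonzero: "q_poly X \<noteq> 0"
  using monic_q_poly[of X] by force

lemma proots_q_poly: "proots (q_poly X) = X"
proof (induction X)
  case (add \<alpha> X)
  have "q_poly (add_mset \<alpha> X) = [:-\<alpha>, 1:] * q_poly X" by (simp add: q_poly_def)
  then show ?case using add by (simp add: proots_mult q_poly_nonzero del: mult_pCons_left)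
qed (simp add: q_poly_def)

lemma alg_closed_eq_smult_q_poly:
  assumes "(f :: 'k::alg_closed_field poly) \<noteq> 0"
  shows "f = Polynomial.smult (lead_coeff f) (q_poly (proots f))"
proof -
  obtain A where A: "f = Polynomial.smult (lead_coeff f) (q_poly A)"
    using alg_closed_imp_factorization[OF assms] by (auto simp: q_poly_def)
  then have "proots f = proots (q_poly A)"
    by (metis assms leading_coeff_0_iff proots_smult)
  with A show ?thesis by (simp add: proots_q_poly)
qed

text \<open>The division in \<^const>\<open>p_poly\<close> is exact because \<open>q\<close> divides \<open>u + C\<close>. Thus the modules
  \<open>A\<^sub>C(X)\<close> correspond to factorizations of \<open>u + C\<close> with a monic second factor.\<close>

lemma p_poly_factorization:
  fixes u :: "'k::alg_closed_field poly"
  assumes "u + [:C:] \<noteq> 0" "X \<subseteq># proots (u + [:C:])"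
  shows "pcompose (p_poly u C X) [:1, 1:] * q_poly X = u + [:C:]"
proof -
  let ?f = "u + [:C:]" and ?qs = "pcompose (q_poly X) [:-1, 1:]"
  define r where "r = Polynomial.smult (lead_coeff ?f) (q_poly (proots ?f - X))"
  have "q_poly (proots ?f) = q_poly (proots ?f - X) * q_poly X"
    using assms(2) by (simp flip: q_poly_add)
  then have r: "?f = r * q_poly X"
    using alg_closed_eq_smult_q_poly[OF assms(1)] by (simp add: r_def)
  have "pcompose u [:-1, 1:] + [:C:] = pcompose ?f [:-1, 1:]"
    by (simp add: pcompose_add)
  also have "\<dots> = pcompose r [:-1, 1:] * ?qs"
    by (simp add: r pcompose_mult)
  finally have "p_poly u C X = pcompose r [:-1, 1:]"
    using q_poly_nonzero[of X]
    by (simp add: p_poly_def)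
      (metis nonzero_mult_div_cancel_right pcompose_0 shift_cancel(2))
  then show ?thesis by (simp add: shift_cancel r)
qed

text \<open>The polynomials \<open>x 1\<close> and \<open>y 1\<close> in the module \<open>F\<^sub>\<lambda> A\<^sub>C(X)\<close>.\<close>

definition operator_pair :: "'k::field poly \<Rightarrow> 'k \<times> 'k \<times> 'k multiset \<Rightarrow> 'k poly \<times> 'k poly" where
  "operator_pair u =
    (\<lambda>(C, l, X). (Polynomial.smult l (q_poly X), Polynomial.smult (inverse l) (p_poly u C X)))"

text \<open>A pair with \<open>p(h + 1) q(h) = u + C\<close> determines \<open>C\<close>, then \<open>\<lambda>\<close> as the leading coefficient of
  \<open>q\<close> and \<open>X\<close> as its multiset of roots. Conversely a polynomial over an algebraically closed
  field is determined by leading coefficient and roots, and \<open>q\<close> and \<open>C\<close> determine \<open>p\<close>, since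
  \<open>u + C\<close> is nonzero.\<close>

lemma bij_betw_operator_pair:
  fixes u :: "'k::{alg_closed_field, field_char_0} poly"
  assumes "pcompose u [:-1, 1:] - u \<noteq> 0"
  shows "bij_betw (operator_pair u) {(C, l, X). l \<noteq> 0 \<and> X \<subseteq># proots (u + [:C:])}
    {(q, p). shift_relation (pcompose u [:-1, 1:] - u) q p}"
proof -
  have nonzero: "u + [:C:] \<noteq> 0" for C
  proof
    assume "u + [:C:] = 0"
    then have "u = [:- C:]" by (simp add: eq_neg_iff_add_eq_0[symmetric])
    with assms show False by simp
  qed
  define params where
    "params = (\<lambda>(q, p). (THE C. pcompose p [:1, 1:] * q = u + [:C:], lead_coeff q, proots q))"
  have params: "params (q, p) = (C, lead_coeff q, proots q)" if "pcompose p [:1, 1:] * q = u + [:C:]" for q p C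
    using that by (auto simp: params_def)
  have fact: "pcompose (Polynomial.smult (inverse l) (p_poly u C X)) [:1, 1:] *
      Polynomial.smult l (q_poly X) = u + [:C:]"
    if "l \<noteq> 0" "X \<subseteq># proots (u + [:C:])" for C l X
    using that p_poly_factorization[OF nonzero that(2)] by (simp add: pcompose_smult)
  show ?thesis
  proof (rule bij_betw_byWitness[where f' = params])
    show "\<forall>t\<in>{(C, l, X). l \<noteq> 0 \<and> X \<subseteq># proots (u + [:C:])}. params (operator_pair u t) = t"
      by (auto simp: operator_pair_def params[OF fact] monic_q_poly proots_q_poly)
    show "operator_pair u ` {(C, l, X). l \<noteq> 0 \<and> X \<subseteq># proots (u + [:C:])}
        \<subseteq> {(q, p). shift_relation (pcompose u [:-1, 1:] - u) q p}"
      by (auto simp: operator_pair_def shift_relation_iff dest: fact)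
    have main: "lead_coeff q \<noteq> 0 \<and> proots q \<subseteq># proots (u + [:C:]) \<and>
        operator_pair u (C, lead_coeff q, proots q) = (q, p)"
      if C: "pcompose p [:1, 1:] * q = u + [:C:]" for q p C
    proof -
      have q: "q \<noteq> 0" "pcompose p [:1, 1:] \<noteq> 0" using C nonzero[of C] by auto
      have sub: "proots q \<subseteq># proots (u + [:C:])"
        using q by (simp add: proots_mult flip: C)
      have q_eq: "Polynomial.smult (lead_coeff q) (q_poly (proots q)) = q"
        using alg_closed_eq_smult_q_poly[OF q(1)] by simp
      let ?p = "Polynomial.smult (inverse (lead_coeff q)) (p_poly u C (proots q))"
      have "pcompose ?p [:1, 1:] * q = pcompose p [:1, 1:] * q"
        using fact[OF _ sub, of "lead_coeff q"] q(1) C by (simp add: q_eq)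
      then have "?p = p" using q(1) by (simp add: pcompose_shift_inj)
      then show ?thesis using q(1) sub by (simp add: operator_pair_def q_eq)
    qed
    then show "\<forall>t\<in>{(q, p). shift_relation (pcompose u [:-1, 1:] - u) q p}. operator_pair u (params t) = t"
      by (auto simp: shift_relation_iff params)
    show "params ` {(q, p). shift_relation (pcompose u [:-1, 1:] - u) q p}
        \<subseteq> {(C, l, X). l \<noteq> 0 \<and> X \<subseteq># proots (u + [:C:])}"
      using main by (auto simp: shift_relation_iff params)
  qed
qed

section \<open>The skeleton\<close>

text \<open>Twisting by \<open>\<phi>\<^sub>\<lambda>\<close> rescales the operators of \<open>x\<close> and \<open>y\<close> by \<open>\<lambda>\<close> and \<open>\<lambda>\<^sup>-\<^sup>1\<close>.\<close>

lemma twist_A_module_eq: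
  assumes "shift_relation g (q_poly X) (p_poly u C X)"
  shows "twist_module g l (A_module u C X) =
    operator_module (case_prod shift_act (operator_pair u (C, l, X)))"
proof -
  let ?T = "shift_act (q_poly X) (p_poly u C X)"
  interpret smith_operators ?T g
    using assms by (rule smith_operators_shift_act)
  have "A_gen_act u C X t f = ?T t f" for t f
    by (cases t) simp_all
  then have "A_gen_act u C X = ?T" by blast
  then have A: "A_module u C X = operator_module ?T"
    by (simp add: A_module_def operator_module_def)
  have "free_act ?T (twist_gen l t) f = case_prod shift_act (operator_pair u (C, l, X)) t f" for t f
    by (cases t) (simp_all add: operator_pair_def act_mult free_act_fconst free_act_fgen)
  then have twist: "(\<lambda>t. free_act ?T (twist_gen l t)) = case_prod shift_act (operator_pair u (C, l, X))"
    by blast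
  have "smith_twist g l s \<odot>\<^bsub>operator_module ?T\<^esub> f =
      free_act (case_prod shift_act (operator_pair u (C, l, X))) (SOME a. a \<in> s) f" for s f
    by (simp only: smith_twist_def operator_module_smult act_free_endo twist)
  then show ?thesis
    by (simp add: twist_module_def A) (simp add: operator_module_def)
qed

theorem corollary3p12:
  fixes g u :: "'k::{alg_closed_field, field_char_0} poly"
  assumes "g \<noteq> 0"
    and "g = pcompose u [:-1, 1:] - u"
  shows "(\<forall>C l X. l \<noteq> 0 \<longrightarrow> X \<subseteq># proots (u + [:C:]) \<longrightarrow>
            in_U1 g (twist_module g l (A_module u C X))) \<and>
         (\<forall>M :: ('k free_alg set, 'm) module. in_U1 g M \<longrightarrow>
            (\<exists>!(C, l, X). l \<noteq> 0 \<and> X \<subseteq># proots (u + [:C:]) \<and>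
               modules_isomorphic (smith_algebra g) M (twist_module g l (A_module u C X))))"
proof -
  let ?params = "{(C, l, X). l \<noteq> 0 \<and> X \<subseteq># proots (u + [:C:])}"
  have bij: "bij_betw (operator_pair u) ?params {(q, p). shift_relation g q p}"
    using bij_betw_operator_pair[of u] assms by simp
  have rel: "shift_relation g (fst (operator_pair u t)) (snd (operator_pair u t))" if "t \<in> ?params" for t
    using bspec[OF bij_betwE[OF bij] that] by (simp add: case_prod_beta)
  have module_eq: "twist_module g l (A_module u C X) =
      operator_module (case_prod shift_act (operator_pair u (C, l, X)))"
    if "l \<noteq> 0" "X \<subseteq># proots (u + [:C:])" for C l X
    \<comment> \<open>the untwisted module has \<open>\<lambda> = 1\<close>\<close>
    using rel[of "(C, 1, X)"] that by (intro twist_A_module_eq) (simp add: operator_pair_def)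
  have in_U1: "in_U1 g (operator_module (case_prod shift_act (operator_pair u t)))" if "t \<in> ?params" for t
    using in_U1_shift_module[OF rel[OF that]] by (simp add: case_prod_beta)
  show ?thesis
  proof (intro conjI allI impI)
    fix C l :: 'k and X :: "'k multiset"
    assume "l \<noteq> 0" "X \<subseteq># proots (u + [:C:])"
    then show "in_U1 g (twist_module g l (A_module u C X))"
      using in_U1[of "(C, l, X)"] by (simp add: module_eq)
  next
    fix M :: "('k free_alg set, 'm) module"
    assume M: "in_U1 g M"
    \<comment> \<open>the pair of \<open>A\<^sub>0(\<emptyset>)\<close>\<close>
    have "shift_relation g 1 (pcompose u [:-1, 1:])"
      by (simp add: shift_relation_def assms(2) shift_cancel pcompose_1)
    with M obtain q p where qp: "shift_relation g q p"
      and iso: "modules_isomorphic (smith_algebra g) M (operator_module (shift_act q p))"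
      by (rule in_U1_imp_shift_module)
    from qp have "(q, p) \<in> operator_pair u ` ?params"
      unfolding bij_betw_imp_surj_on[OF bij] by simp
    then obtain t\<^sub>0 where t\<^sub>0: "(q, p) = operator_pair u t\<^sub>0" "t\<^sub>0 \<in> ?params"
      by (rule imageE)
    have iso_iff: "modules_isomorphic (smith_algebra g) M
        (operator_module (case_prod shift_act (operator_pair u t))) \<longleftrightarrow> t = t\<^sub>0" if "t \<in> ?params" for t
    proof
      assume "modules_isomorphic (smith_algebra g) M
        (operator_module (case_prod shift_act (operator_pair u t)))"
      then have "modules_isomorphic (smith_algebra g) (operator_module (shift_act q p))
          (operator_module (shift_act (fst (operator_pair u t)) (snd (operator_pair u t))))"
        using isomorphic_to_common_module[OF _ iso] M by (simp add: in_U1_def case_prod_beta)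
      from shift_module_iso_imp_eq[OF qp rel[OF that] this]
      have "operator_pair u t = operator_pair u t\<^sub>0" by (simp add: t\<^sub>0(1)[symmetric] prod_eq_iff)
      then show "t = t\<^sub>0"
        using that t\<^sub>0(2) by (rule inj_onD[OF bij_betw_imp_inj_on[OF bij]])
    qed (simp add: t\<^sub>0(1)[symmetric] iso)
    have "(l \<noteq> 0 \<and> X \<subseteq># proots (u + [:C:]) \<and>
        modules_isomorphic (smith_algebra g) M (twist_module g l (A_module u C X))) \<longleftrightarrow>
        (C, l, X) = t\<^sub>0" for C l X
      using iso_iff[of "(C, l, X)"] t\<^sub>0(2) module_eq[of l X C] by auto
    then show "\<exists>!(C, l, X). l \<noteq> 0 \<and> X \<subseteq># proots (u + [:C:]) \<and>
        modules_isomorphic (smith_algebra g) M (twist_module g l (A_module u C X))"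
      by (simp only:) (rule ex1I[of _ t\<^sub>0], auto)
  qed
qed

end
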